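(* Let $\mu$ be a probability measure on the unit circle $\mathbb{T}$ with infinite support, and let $(x_n)_{n\ge 0}$ be its sequence of orthonormal Laurent polynomials (obtained from $1,z^{-1},z,z^{-2},z^2,\dots$). Then there exists a linear differential operator $D\colon \mathbb{C}[z,z^{-1}]\to\mathbb{C}[z,z^{-1}]$ of some (arbitrary) order $r\ge 1$ such that, for all but finitely many $n$, $x_n$ is an eigenfunction of $D$ (i.e. $Dx_n=\lambda_n x_n$ for some $\lambda_n\in\mathbb{C}$), if and only if $\mu$ is the (normalized) Lebesgue measure on $\mathbb{T}$.
   Context: $\mathbb{T}=\{z\in\mathbb{C}:|z|=1\}$, and $\mathbb{C}[z,z^{-1}]$ is the space of complex Laurent polynomials. For a probability measure $\mu$ on $\mathbb{T}$ with infinite support, $(x_n)_{n\ge0}$ denotes the sequence of orthonormal Laurent polynomials (OLP) produced by Gram–Schmidt orthonormalization (with positive leading coefficients) in $L^2_\mu$ of the ordered sequence $1,z^{-1},z,z^{-2},z^2,\dots$. For the normalized Lebesgue (arc length) measure, $x_{2m-1}(z)=z^{-m}$ and $x_{2m}(z)=z^m$. A linear differential operator $D\colon\mathbb{C}[z,z^{-1}]\to\mathbb{C}[z,z^{-1}]$ of order $r\ge1$ is $D=\sum_{k=0}^r D_k(z)\frac{d^k}{dz^k}$ with $D_k\in\mathbb{C}[z,z^{-1}]$ and $D_r\neq0$. *)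

theory Defs
  imports "HOL-Probability.Probability" "HOL-Library.Poly_Mapping"
begin

text \<open>
  \<open>\<complex>[z, z\<^sup>-\<^sup>1]\<close> is the group algebra of the integers: a Laurent polynomial is the finitely
  supported family of its coefficients, and the ring operations are those of
  \<^theory>\<open>HOL-Library.Poly_Mapping\<close>.
\<close>

type_synonym laurent = "int \<Rightarrow>\<^sub>0 complex"

definition laurent_monom :: "int \<Rightarrow> laurent" where
  "laurent_monom k = Poly_Mapping.single k 1"

definition laurent_smult :: "complex \<Rightarrow> laurent \<Rightarrow> laurent" where
  "laurent_smult c p = Poly_Mapping.single 0 c * p"

definition laurent_eval :: "laurent \<Rightarrow> complex \<Rightarrow> complex" where
  "laurent_eval p z = (\<Sum>k\<in>Poly_Mapping.keys p. Poly_Mapping.lookup p k * z powi k)"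

definition laurent_deriv :: "laurent \<Rightarrow> laurent" where
  "laurent_deriv p =
     (\<Sum>k\<in>Poly_Mapping.keys p. Poly_Mapping.single (k - 1) (of_int k * Poly_Mapping.lookup p k))"

definition is_diff_operator :: "nat \<Rightarrow> (laurent \<Rightarrow> laurent) \<Rightarrow> bool" where
  "is_diff_operator r D \<longleftrightarrow>
     (\<exists>a :: nat \<Rightarrow> laurent. a r \<noteq> 0 \<and> (\<forall>p. D p = (\<Sum>k\<le>r. a k * (laurent_deriv ^^ k) p)))"

text \<open>
  A measure on the unit circle is a measure whose \<open>\<sigma>\<close>-algebra is the following one, so its
  underlying space is the circle itself and not the whole complex plane.
\<close>

definition circle_borel :: "complex measure" where
  "circle_borel = restrict_space borel (sphere 0 1)"

definition measure_support :: "complex measure \<Rightarrow> complex set" where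
  "measure_support \<mu> =
     {z \<in> space \<mu>. \<forall>U. open U \<and> z \<in> U \<longrightarrow> emeasure \<mu> (U \<inter> space \<mu>) > 0}"

definition arc_length_measure :: "complex measure" where
  "arc_length_measure = distr (uniform_measure lborel {0..<2 * pi}) circle_borel cis"

definition laurent_inner :: "complex measure \<Rightarrow> laurent \<Rightarrow> laurent \<Rightarrow> complex" where
  "laurent_inner \<mu> p q = (\<integral>z. laurent_eval p z * cnj (laurent_eval q z) \<partial>\<mu>)"

definition laurent_norm :: "complex measure \<Rightarrow> laurent \<Rightarrow> real" where
  "laurent_norm \<mu> p = sqrt (Re (laurent_inner \<mu> p p))"

text \<open>The exponents \<open>0, -1, 1, -2, 2, \<dots>\<close> of the ordered sequence to be orthonormalized.\<close>

definition olp_exponent :: "nat \<Rightarrow> int" where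
  "olp_exponent n = (if even n then int (n div 2) else - int ((n + 1) div 2))"

text \<open>
  Gram--Schmidt. The coefficient of the new monomial in \<open>olp \<mu> n\<close> is the reciprocal of the norm
  of the residual, hence positive when \<open>\<mu>\<close> has infinite support.
\<close>

function olp :: "complex measure \<Rightarrow> nat \<Rightarrow> laurent" where
  "olp \<mu> n =
     (let b = laurent_monom (olp_exponent n);
          y = b - (\<Sum>k\<in>{..<n}. laurent_smult (laurent_inner \<mu> b (olp \<mu> k)) (olp \<mu> k))
      in laurent_smult (complex_of_real (1 / laurent_norm \<mu> y)) y)"
  by pat_completeness auto
termination
  by (relation "Wellfounded.measure snd") auto

declare olp.simps [simp del]

end

theory Submission
  imports Defs "HOL-Computational_Algebra.Fundamental_Theorem_Algebra"
begin

text \<open>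
  Write a differential operator as \<open>D = (\<Sum>j. z\<^sup>j P\<^sub>j(\<theta>))\<close> with \<open>\<theta> = z d/dz\<close> and
  polynomials \<open>P\<^sub>j\<close>, so that \<open>D z\<^sup>k = (\<Sum>j. P\<^sub>j(k) z\<^bsup>k+j\<^esup>)\<close>; only finitely many
  \<open>P\<^sub>j\<close> are nonzero. Suppose almost all \<open>x\<^sub>n\<close> are eigenfunctions. The exponents of
  \<open>x\<^sub>2\<^sub>m\<close> lie in \<open>[-m, m]\<close> and \<open>z\<^sup>m\<close> does occur; if \<open>J > 0\<close> were the largest shift in \<open>D\<close>,
  then the coefficient of \<open>z\<^bsup>m+J\<^esup>\<close> in \<open>D x\<^sub>2\<^sub>m\<close>, which has to vanish, would be a nonzero multiple
  of \<open>P\<^sub>J(m)\<close>. So \<open>P\<^sub>J\<close> would have infinitely many roots. In the same way the functions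
  \<open>x\<^sub>2\<^sub>m\<^sub>-\<^sub>1\<close>, whose lowest exponent is \<open>-m\<close>, exclude negative shifts
  (\<open>eigen_shift_symbol_zero\<close>). Hence \<open>D = P\<^sub>0(\<theta>)\<close> is diagonal in the monomials, and the degree of
  \<open>P\<^sub>0\<close> is the order of \<open>D\<close>, so \<open>P\<^sub>0\<close> is not constant.

  All exponents that occur in an eigenfunction now have the same value under \<open>P\<^sub>0\<close>. Since
  \<open>|P\<^sub>0|\<close> is unbounded on the integers, there are arbitrarily large record radii \<open>m\<close>, at which
  \<open>|P\<^sub>0(m)|\<close> or \<open>|P\<^sub>0(-m)|\<close> exceeds a bound valid on \<open>]-m, m[\<close> (\<open>record_radius\<close>). If
  \<open>|P\<^sub>0(-m)|\<close> does, then \<open>-m\<close> is the only exponent of \<open>x\<^sub>2\<^sub>m\<^sub>-\<^sub>1\<close>, since \<open>m\<close> is not available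
  there; otherwise \<open>m\<close> is the only exponent of \<open>x\<^sub>2\<^sub>m\<close>. In both cases a monomial \<open>z\<^bsup>\<plusminus>m\<^esup>\<close> is orthogonal
  to all monomials that precede it, which says that the moments \<open>\<integral>z\<^sup>j d\<mu>\<close> with
  \<open>0 < |j| < m\<close> vanish (\<open>eigenoperator_imp_moments_zero\<close>). As \<open>m\<close> is arbitrarily large, all
  moments of \<open>\<mu>\<close> are those of arc length, and by the Weierstrass approximation theorem the
  moments determine a measure on the circle (\<open>circle_prob_eqI\<close>).

  Conversely, for arc length the monomials are orthonormal, so Gram--Schmidt returns them
  unchanged, and they are eigenfunctions of \<open>\<theta>\<close>.
\<close>

section \<open>Coefficients and values of Laurent polynomials\<close>

lemma laurent_sum_single:
  fixes p :: laurent
  assumes "finite K" "Poly_Mapping.keys p \<subseteq> K"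
  shows "p = (\<Sum>k\<in>K. Poly_Mapping.single k (Poly_Mapping.lookup p k))"
proof (rule poly_mapping_eqI)
  fix j
  have "(\<Sum>k\<in>K. Poly_Mapping.lookup (Poly_Mapping.single k (Poly_Mapping.lookup p k)) j)
      = (\<Sum>k\<in>K. if k = j then Poly_Mapping.lookup p j else 0)"
    by (rule sum.cong) (auto simp: lookup_single when_def)
  also have "\<dots> = Poly_Mapping.lookup p j"
    using assms by (auto simp: sum.delta in_keys_iff)
  finally show "Poly_Mapping.lookup p j =
      Poly_Mapping.lookup (\<Sum>k\<in>K. Poly_Mapping.single k (Poly_Mapping.lookup p k)) j"
    by (simp add: lookup_sum)
qed

lemma lookup_times_single:
  "Poly_Mapping.lookup (a * Poly_Mapping.single k c :: laurent) l = Poly_Mapping.lookup a (l - k) * c"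
proof -
  have "a * Poly_Mapping.single k c =
      (\<Sum>j\<in>Poly_Mapping.keys a. Poly_Mapping.single (j + k) (Poly_Mapping.lookup a j * c))"
    by (subst laurent_sum_single[of "Poly_Mapping.keys a" a])
       (auto simp: sum_distrib_right mult_single)
  then have "Poly_Mapping.lookup (a * Poly_Mapping.single k c) l =
      (\<Sum>j\<in>Poly_Mapping.keys a. if j = l - k then Poly_Mapping.lookup a (l - k) * c else 0)"
    by (simp only: lookup_sum) (rule sum.cong, auto simp: lookup_single when_def)
  also have "\<dots> = Poly_Mapping.lookup a (l - k) * c"
    by (auto simp: sum.delta in_keys_iff)
  finally show ?thesis .
qed

lemma lookup_times_superset:
  fixes a p :: laurent
  assumes "finite K" "Poly_Mapping.keys p \<subseteq> K"
  shows "Poly_Mapping.lookup (a * p) l =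
    (\<Sum>k\<in>K. Poly_Mapping.lookup a (l - k) * Poly_Mapping.lookup p k)"
  by (subst laurent_sum_single[OF assms])
     (simp add: sum_distrib_left lookup_sum lookup_times_single)

lemma lookup_laurent_smult [simp]:
  "Poly_Mapping.lookup (laurent_smult c p) l = c * Poly_Mapping.lookup p l"
  unfolding laurent_smult_def by (subst mult.commute) (simp add: lookup_times_single)

lemma lookup_laurent_monom:
  "Poly_Mapping.lookup (laurent_monom k) l = (if l = k then 1 else 0)"
  by (auto simp: laurent_monom_def lookup_single when_def)

lemma laurent_eval_superset:
  assumes "finite K" "Poly_Mapping.keys p \<subseteq> K"
  shows "laurent_eval p z = (\<Sum>k\<in>K. Poly_Mapping.lookup p k * z powi k)"
  unfolding laurent_eval_def
  by (rule sum.mono_neutral_left) (use assms in \<open>auto simp: in_keys_iff\<close>)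

lemma laurent_eval_single [simp]: "laurent_eval (Poly_Mapping.single k c) z = c * z powi k"
  by (subst laurent_eval_superset[of "{k}"]) (auto simp: lookup_single)

lemma laurent_eval_monom [simp]: "laurent_eval (laurent_monom k) z = z powi k"
  by (simp add: laurent_monom_def)

lemma laurent_eval_zero [simp]: "laurent_eval 0 z = 0"
  by (simp add: laurent_eval_def)

lemma laurent_eval_add: "laurent_eval (p + q) z = laurent_eval p z + laurent_eval q z"
proof -
  let ?K = "Poly_Mapping.keys p \<union> Poly_Mapping.keys q"
  have "Poly_Mapping.keys (p + q) \<subseteq> ?K" by (rule keys_add)
  then show ?thesis
    by (simp add: laurent_eval_superset[of ?K] lookup_add algebra_simps sum.distrib)
qed

lemma laurent_eval_sum: "laurent_eval (sum f A) z = (\<Sum>x\<in>A. laurent_eval (f x) z)"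
  by (induction A rule: infinite_finite_induct) (auto simp: laurent_eval_add)

lemma laurent_eval_mult:
  assumes "z \<noteq> 0"
  shows "laurent_eval (p * q) z = laurent_eval p z * laurent_eval q z"
proof -
  have "p * q = (\<Sum>j\<in>Poly_Mapping.keys p. \<Sum>k\<in>Poly_Mapping.keys q.
      Poly_Mapping.single (j + k) (Poly_Mapping.lookup p j * Poly_Mapping.lookup q k))"
    by (subst laurent_sum_single[of "Poly_Mapping.keys p" p], simp, simp,
        subst laurent_sum_single[of "Poly_Mapping.keys q" q], simp, simp)
       (simp add: sum_product mult_single)
  then show ?thesis
    using assms
    by (simp add: laurent_eval_sum laurent_eval_def[of p] laurent_eval_def[of q] sum_product
        power_int_add mult_ac)
qed

lemma laurent_eval_smult [simp]: "laurent_eval (laurent_smult c p) z = c * laurent_eval p z"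
proof -
  have "Poly_Mapping.keys (laurent_smult c p) \<subseteq> Poly_Mapping.keys p"
    by (auto simp: in_keys_iff)
  then show ?thesis
    by (simp add: laurent_eval_superset[of "Poly_Mapping.keys p"] sum_distrib_left mult_ac)
qed

lemma laurent_eval_diff: "laurent_eval (p - q) z = laurent_eval p z - laurent_eval q z"
  using laurent_eval_add[of "p - q" q z] by simp

text \<open>Multiplying by a power of \<open>z\<close> turns a Laurent polynomial into a polynomial with nonzero
  constant coefficient, without changing its zeros off the origin.\<close>

lemma finite_zeros_laurent_eval:
  assumes "p \<noteq> 0"
  shows "finite {z. z \<noteq> 0 \<and> laurent_eval p z = 0}"
proof -
  define K where "K = Poly_Mapping.keys p"
  have K: "finite K" "K \<noteq> {}" using assms by (auto simp: K_def)
  define m where "m = Min K"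
  define Q where "Q = (\<Sum>k\<in>K. monom (Poly_Mapping.lookup p k) (nat (k - m)))"
  have m: "m \<in> K" "\<And>k. k \<in> K \<Longrightarrow> m \<le> k" using K by (auto simp: m_def)
  have "coeff Q 0 = (\<Sum>k\<in>K. if k = m then Poly_Mapping.lookup p m else 0)"
    unfolding Q_def by (auto simp: coeff_sum intro!: sum.cong) (use m in force)
  also have "\<dots> = Poly_Mapping.lookup p m" using m K by (simp add: sum.delta)
  also have "\<dots> \<noteq> 0" using m by (simp add: K_def in_keys_iff)
  finally have "Q \<noteq> 0" by auto
  then have "finite {z. poly Q z = 0}" by (rule poly_roots_finite)
  moreover have "poly Q z = z powi (- m) * laurent_eval p z" if "z \<noteq> 0" for z
  proof -
    have "z ^ nat (k - m) = z powi (- m) * z powi k" if "k \<in> K" for k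
      using m(2)[OF that] \<open>z \<noteq> 0\<close>
      by (simp flip: power_int_of_nat power_int_add)
    then show ?thesis
      by (simp add: Q_def poly_sum poly_monom laurent_eval_def K_def[symmetric]
          sum_distrib_left mult_ac)
  qed
  ultimately show ?thesis by (auto elim: finite_subset[rotated])
qed

section \<open>Differential operators acting on monomials\<close>

lemma lookup_laurent_deriv:
  "Poly_Mapping.lookup (laurent_deriv p) l = of_int (l + 1) * Poly_Mapping.lookup p (l + 1)"
proof -
  have "Poly_Mapping.lookup (laurent_deriv p) l = (\<Sum>k\<in>Poly_Mapping.keys p.
      if k = l + 1 then of_int (l + 1) * Poly_Mapping.lookup p (l + 1) else 0)"
    by (simp only: laurent_deriv_def lookup_sum) (rule sum.cong, auto simp: lookup_single when_def)
  also have "\<dots> = of_int (l + 1) * Poly_Mapping.lookup p (l + 1)"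
    by (auto simp: sum.delta in_keys_iff)
  finally show ?thesis .
qed

text \<open>The falling factorial \<open>x (x - 1) \<dots> (x - i + 1)\<close>, which is the factor that the \<open>i\<close>-th
  derivative produces on \<open>z\<^sup>x\<close>.\<close>

definition falling_poly :: "nat \<Rightarrow> complex poly" where
  "falling_poly i = (\<Prod>l<i. [:- of_nat l, 1:])"

lemma falling_poly_Suc: "falling_poly (Suc i) = [:- of_nat i, 1:] * falling_poly i"
  by (simp add: falling_poly_def mult.commute)

lemma degree_falling_poly: "degree (falling_poly i) = i"
  by (simp add: falling_poly_def degree_prod_eq_sum_degree)

lemma lead_coeff_falling_poly: "coeff (falling_poly i) i = 1"
proof -
  have "lead_coeff (falling_poly i) = 1"
    by (simp add: falling_poly_def lead_coeff_prod)
  then show ?thesis by (simp add: degree_falling_poly)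
qed

lemma lookup_laurent_deriv_iterated:
  "Poly_Mapping.lookup ((laurent_deriv ^^ i) p) l =
     poly (falling_poly i) (of_int (l + int i)) * Poly_Mapping.lookup p (l + int i)"
proof (induction i arbitrary: l)
  case 0
  then show ?case by (simp add: falling_poly_def)
next
  case (Suc i)
  have "l + 1 + int i = l + int (Suc i)" by simp
  then show ?case
    by (simp only: funpow.simps o_apply lookup_laurent_deriv Suc.IH)
       (simp add: falling_poly_Suc algebra_simps)
qed

text \<open>The polynomial \<open>P\<^sub>j\<close> in \<open>(\<Sum>i\<le>r. a\<^sub>i d\<^sup>i/dz\<^sup>i) = (\<Sum>j. z\<^sup>j P\<^sub>j(\<theta>))\<close>, where
  \<open>\<theta> = z d/dz\<close>. The term of \<open>a\<^sub>i\<close> with exponent \<open>j + i\<close> contributes to the shift \<open>j\<close>, because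
  \<open>z\<^sup>i d\<^sup>i/dz\<^sup>i\<close> is the falling factorial of \<open>\<theta>\<close>.\<close>

definition shift_symbol :: "nat \<Rightarrow> (nat \<Rightarrow> laurent) \<Rightarrow> int \<Rightarrow> complex poly" where
  "shift_symbol r a j =
     (\<Sum>i\<le>r. smult (Poly_Mapping.lookup (a i) (j + int i)) (falling_poly i))"

text \<open>Only the summand \<open>i = r\<close> reaches degree \<open>r\<close>, so the leading coefficient \<open>a\<^sub>r\<close> of the operator
  shows in the symbols without cancellation. This is what makes the diagonal symbol nonconstant.\<close>

lemma coeff_shift_symbol:
  "coeff (shift_symbol r a j) r = Poly_Mapping.lookup (a r) (j + int r)"
proof -
  have "coeff (shift_symbol r a j) r =
      (\<Sum>i\<le>r. if i = r then Poly_Mapping.lookup (a r) (j + int r) else 0)"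
    unfolding shift_symbol_def coeff_sum
    by (rule sum.cong) (auto simp: lead_coeff_falling_poly degree_falling_poly coeff_eq_0)
  then show ?thesis by simp
qed

lemma finite_shift_symbol_nonzero: "finite {j. shift_symbol r a j \<noteq> 0}"
proof (rule finite_subset)
  show "{j. shift_symbol r a j \<noteq> 0}
      \<subseteq> (\<Union>i\<le>r. (\<lambda>k. k - int i) ` Poly_Mapping.keys (a i))"
  proof
    fix j assume "j \<in> {j. shift_symbol r a j \<noteq> 0}"
    then obtain i where "i \<le> r" "Poly_Mapping.lookup (a i) (j + int i) \<noteq> 0"
      unfolding shift_symbol_def mem_Collect_eq
      by (metis (no_types, lifting) atMost_iff smult_0_left sum.neutral)
    then show "j \<in> (\<Union>i\<le>r. (\<lambda>k. k - int i) ` Poly_Mapping.keys (a i))"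
      by (force simp: in_keys_iff image_iff)
  qed
qed simp

text \<open>On the monomial \<open>z\<^sup>k\<close> each \<open>\<theta>\<close> acts as the number \<open>k\<close>, so the part of \<open>D\<close> that shifts
  exponents by \<open>l - k\<close> takes \<open>z\<^sup>k\<close> to \<open>P\<^bsub>l-k\<^esub>(k) z\<^sup>l\<close>.\<close>

lemma lookup_diff_operator:
  assumes "D p = (\<Sum>i\<le>r. a i * (laurent_deriv ^^ i) p)"
  shows "Poly_Mapping.lookup (D p) l =
    (\<Sum>k\<in>Poly_Mapping.keys p. poly (shift_symbol r a (l - k)) (of_int k) * Poly_Mapping.lookup p k)"
proof -
  let ?K = "Poly_Mapping.keys p"
  have *: "Poly_Mapping.lookup (a i * (laurent_deriv ^^ i) p) l =
      (\<Sum>k\<in>?K. Poly_Mapping.lookup (a i) (l - k + int i) * poly (falling_poly i) (of_int k)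
        * Poly_Mapping.lookup p k)" for i
  proof -
    have "Poly_Mapping.keys ((laurent_deriv ^^ i) p) \<subseteq> (\<lambda>k. k - int i) ` ?K"
      by (force simp: in_keys_iff lookup_laurent_deriv_iterated image_iff)
    then have "Poly_Mapping.lookup (a i * (laurent_deriv ^^ i) p) l =
        (\<Sum>k\<in>(\<lambda>k. k - int i) ` ?K.
           Poly_Mapping.lookup (a i) (l - k) * Poly_Mapping.lookup ((laurent_deriv ^^ i) p) k)"
      by (intro lookup_times_superset) auto
    also have "\<dots> = (\<Sum>k\<in>?K. Poly_Mapping.lookup (a i) (l - (k - int i)) *
        Poly_Mapping.lookup ((laurent_deriv ^^ i) p) (k - int i))"
      by (subst sum.reindex) (auto simp: inj_on_def)
    finally show ?thesis
      by (simp add: lookup_laurent_deriv_iterated algebra_simps)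
  qed
  show ?thesis
    unfolding assms lookup_sum * shift_symbol_def
    by (subst sum.swap) (simp add: poly_sum sum_distrib_right)
qed

section \<open>Probability measures on the circle\<close>

locale circle_prob = prob_space \<mu> for \<mu> :: "complex measure" +
  assumes sets_circle: "sets \<mu> = sets circle_borel"
begin

lemma space_circle: "space \<mu> = sphere 0 1"
  using sets_eq_imp_space_eq[OF sets_circle] by (simp add: circle_borel_def space_restrict_space)

lemma measurable_continuous:
  fixes f :: "complex \<Rightarrow> 'b::{banach, second_countable_topology}"
  assumes "continuous_on (sphere 0 1) f"
  shows "f \<in> borel_measurable \<mu>"
  using borel_measurable_continuous_on_restrict[OF assms]
  by (simp add: measurable_cong_sets[OF sets_circle refl] circle_borel_def)

lemma integrable_continuous:
  fixes f :: "complex \<Rightarrow> 'b::{banach, second_countable_topology}"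
  assumes "continuous_on (sphere 0 1) f"
  shows "integrable \<mu> f"
proof -
  have "bounded (f ` sphere 0 1)"
    by (intro compact_imp_bounded compact_continuous_image assms compact_sphere)
  then obtain B where "\<And>z. z \<in> sphere 0 1 \<Longrightarrow> norm (f z) \<le> B"
    unfolding bounded_iff by blast
  then show ?thesis
    by (intro integrable_const_bound[of _ B] measurable_continuous assms)
       (auto simp: space_circle)
qed

end

lemma continuous_on_laurent_eval: "continuous_on (sphere 0 1) (laurent_eval p)"
  unfolding laurent_eval_def by (intro continuous_intros) auto

lemma cnj_circle_powi:
  assumes "z \<in> sphere (0::complex) 1"
  shows "cnj (z powi k) = z powi (- k)"
proof -
  have "z * cnj z = 1"
    using assms by (simp flip: complex_norm_square)
  then have "cnj z = inverse z" by (metis inverse_unique)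
  then show ?thesis by (simp add: power_int_minus power_int_inverse)
qed

context circle_prob
begin

lemma integrable_inner: "integrable \<mu> (\<lambda>z. laurent_eval p z * cnj (laurent_eval q z))"
  by (intro integrable_continuous continuous_intros continuous_on_laurent_eval)

lemma laurent_inner_diff_left:
  "laurent_inner \<mu> (p - q) r = laurent_inner \<mu> p r - laurent_inner \<mu> q r"
  by (simp add: laurent_inner_def laurent_eval_diff left_diff_distrib integrable_inner
      Bochner_Integration.integral_diff)

lemma laurent_inner_smult_left:
  "laurent_inner \<mu> (laurent_smult c p) q = c * laurent_inner \<mu> p q"
  by (simp add: laurent_inner_def mult.assoc)

lemma laurent_inner_sum_left:
  "laurent_inner \<mu> (sum f A) q = (\<Sum>x\<in>A. laurent_inner \<mu> (f x) q)"
  unfolding laurent_inner_def laurent_eval_sum sum_distrib_right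
  by (intro Bochner_Integration.integral_sum integrable_inner)

lemma laurent_inner_cnj: "laurent_inner \<mu> q p = cnj (laurent_inner \<mu> p q)"
proof -
  have "cnj (laurent_inner \<mu> p q) = (\<integral>z. cnj (laurent_eval p z * cnj (laurent_eval q z)) \<partial>\<mu>)"
    unfolding laurent_inner_def by (rule Bochner_Integration.integral_cnj[symmetric])
  then show ?thesis by (simp add: laurent_inner_def mult.commute)
qed

lemma laurent_inner_monom:
  "laurent_inner \<mu> (laurent_monom j) (laurent_monom k) = (\<integral>z. z powi (j - k) \<partial>\<mu>)"
  unfolding laurent_inner_def
proof (rule Bochner_Integration.integral_cong[OF refl])
  fix z assume "z \<in> space \<mu>"
  then have z: "z \<in> sphere 0 1" by (simp only: space_circle)
  then have "z \<noteq> 0" by auto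
  have "laurent_eval (laurent_monom j) z * cnj (laurent_eval (laurent_monom k) z)
      = z powi j * z powi (- k)"
    using cnj_circle_powi[OF z] by simp
  also have "\<dots> = z powi (j - k)"
    using \<open>z \<noteq> 0\<close> by (simp flip: power_int_add)
  finally show "laurent_eval (laurent_monom j) z * cnj (laurent_eval (laurent_monom k) z)
      = z powi (j - k)" .
qed

lemma laurent_inner_self: "laurent_inner \<mu> p p = of_real (\<integral>z. (norm (laurent_eval p z))\<^sup>2 \<partial>\<mu>)"
  unfolding laurent_inner_def complex_norm_square[symmetric] by (simp flip: of_real_power)

lemma laurent_norm_square: "(of_real (laurent_norm \<mu> p))\<^sup>2 = laurent_inner \<mu> p p"
proof -
  have "(laurent_norm \<mu> p)\<^sup>2 = (\<integral>z. (norm (laurent_eval p z))\<^sup>2 \<partial>\<mu>)"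
    by (simp add: laurent_norm_def laurent_inner_self)
  then show ?thesis unfolding laurent_inner_self by (simp flip: of_real_power)
qed

text \<open>A Laurent polynomial of norm zero vanishes almost everywhere. Then the complement of its zero set
  on the circle is an open null set, so the support lies in that finite zero set.\<close>

lemma laurent_norm_pos:
  assumes supp: "infinite (measure_support \<mu>)" and "p \<noteq> 0"
  shows "laurent_norm \<mu> p > 0"
proof (rule ccontr)
  let ?f = "\<lambda>z. (norm (laurent_eval p z))\<^sup>2"
  assume "\<not> laurent_norm \<mu> p > 0"
  then have "(\<integral>z. ?f z \<partial>\<mu>) = 0"
    by (auto simp: laurent_norm_def laurent_inner_self intro!: antisym)
  moreover have "integrable \<mu> ?f"
    by (intro integrable_continuous continuous_intros continuous_on_laurent_eval)
  ultimately have ae: "AE z in \<mu>. ?f z = 0"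
    by (subst (asm) integral_nonneg_eq_0_iff_AE) auto
  define Z where "Z = {z \<in> sphere 0 1. laurent_eval p z = 0}"
  have "finite Z"
    by (rule finite_subset[OF _ finite_zeros_laurent_eval[OF \<open>p \<noteq> 0\<close>]]) (auto simp: Z_def)
  have "measure_support \<mu> \<subseteq> Z"
  proof
    fix z assume z: "z \<in> measure_support \<mu>"
    show "z \<in> Z"
    proof (rule ccontr)
      assume "z \<notin> Z"
      have "open (- Z)" using \<open>finite Z\<close> by (simp add: finite_imp_closed open_Compl)
      then have "emeasure \<mu> (- Z \<inter> space \<mu>) > 0"
        using z \<open>z \<notin> Z\<close> by (auto simp: measure_support_def)
      moreover have "AE w in \<mu>. w \<notin> - Z \<inter> space \<mu>"
        using ae by eventually_elim (auto simp: Z_def space_circle)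
      moreover have "- Z \<inter> space \<mu> \<in> sets \<mu>"
        using \<open>open (- Z)\<close>
        by (auto simp: sets_circle circle_borel_def sets_restrict_space space_circle)
      ultimately show False
        using AE_iff_null_sets[of "- Z \<inter> space \<mu>" \<mu>] by (auto dest: null_setsD1)
    qed
  qed
  then show False using supp \<open>finite Z\<close> finite_subset by blast
qed

end

section \<open>Trigonometric moments determine the measure\<close>

text \<open>On the circle \<open>Re z = (z + 1/z) / 2\<close> and \<open>Im z = (z - 1/z) / (2\<i>)\<close>, so every polynomial in
  the real coordinates is the restriction of a Laurent polynomial.\<close>

lemma real_polynomial_function_laurent:
  assumes "real_polynomial_function g"
  shows "\<exists>p. \<forall>z\<in>sphere 0 1. complex_of_real (g z) = laurent_eval p z"
  using assms
proof induction
  case (linear f)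
  interpret bounded_linear f by fact
  let ?p = "Poly_Mapping.single 1 ((of_real (f 1) - \<i> * of_real (f \<i>)) / 2)
    + Poly_Mapping.single (-1) ((of_real (f 1) + \<i> * of_real (f \<i>)) / 2) :: laurent"
  have "complex_of_real (f z) = laurent_eval ?p z" if z: "z \<in> sphere 0 1" for z
  proof -
    have "z = Re z *\<^sub>R 1 + Im z *\<^sub>R \<i>" by (simp add: complex_eq_iff)
    then have f: "f z = Re z * f 1 + Im z * f \<i>"
      by (metis add scaleR real_scaleR_def)
    have "inverse z = cnj z" using cnj_circle_powi[OF z, of 1] by simp
    then show ?thesis
      unfolding f laurent_eval_add laurent_eval_single power_int_1_right power_int_minus
      by (simp only: \<open>inverse z = cnj z\<close>) (simp add: complex_eq_iff field_simps)
  qed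
  then show ?case by blast
next
  case (const c)
  show ?case by (intro exI[of _ "Poly_Mapping.single 0 (of_real c)"]) simp
next
  case (add f g)
  then show ?case by (metis laurent_eval_add of_real_add)
next
  case (mult f g)
  then obtain p q where "\<forall>z\<in>sphere 0 1. complex_of_real (f z) = laurent_eval p z"
    "\<forall>z\<in>sphere 0 1. complex_of_real (g z) = laurent_eval q z" by blast
  moreover have "z \<noteq> 0" if "z \<in> sphere (0::complex) 1" for z using that by auto
  ultimately show ?case by (intro exI[of _ "p * q"]) (auto simp: laurent_eval_mult)
qed

text \<open>Equal moments give equal integrals of Laurent polynomials, hence of real polynomial functions,
  hence by uniform approximation of all continuous functions. Indicators of closed sets are
  pointwise limits of continuous functions, and the closed sets generate the Borel sets.\<close>

lemma circle_prob_eqI: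
  assumes "circle_prob \<mu>" "circle_prob \<nu>"
    and moments: "\<And>k. (\<integral>z. z powi k \<partial>\<mu>) = (\<integral>z. z powi k \<partial>\<nu>)"
  shows "\<mu> = \<nu>"
proof -
  interpret M: circle_prob \<mu> by fact
  interpret N: circle_prob \<nu> by fact
  have powi: "continuous_on (sphere 0 1) (\<lambda>z::complex. z powi k)" for k
    by (intro continuous_intros) auto
  have laurent: "(\<integral>z. laurent_eval p z \<partial>\<mu>) = (\<integral>z. laurent_eval p z \<partial>\<nu>)" for p
    unfolding laurent_eval_def
    by (simp add: Bochner_Integration.integral_sum M.integrable_continuous N.integrable_continuous
        powi moments)
  have poly: "(\<integral>z. g z \<partial>\<mu>) = (\<integral>z. g z \<partial>\<nu>)" if g: "real_polynomial_function g" for g :: "complex \<Rightarrow> real"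
  proof -
    obtain p where p: "\<forall>z\<in>sphere 0 1. complex_of_real (g z) = laurent_eval p z"
      using real_polynomial_function_laurent[OF g] by blast
    have "complex_of_real (\<integral>z. g z \<partial>\<mu>) = (\<integral>z. laurent_eval p z \<partial>\<mu>)"
      unfolding integral_complex_of_real[symmetric]
      by (rule Bochner_Integration.integral_cong) (use p in \<open>auto simp: M.space_circle\<close>)
    also have "\<dots> = (\<integral>z. laurent_eval p z \<partial>\<nu>)" by (rule laurent)
    also have "\<dots> = complex_of_real (\<integral>z. g z \<partial>\<nu>)"
      unfolding integral_complex_of_real[symmetric]
      by (rule Bochner_Integration.integral_cong) (use p in \<open>auto simp: N.space_circle\<close>)
    finally show ?thesis by (simp only: of_real_eq_iff)
  qed
  have cont: "(\<integral>z. f z \<partial>\<mu>) = (\<integral>z. f z \<partial>\<nu>)"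
    if f: "continuous_on (sphere 0 1) f" for f :: "complex \<Rightarrow> real"
  proof -
    have "\<bar>(\<integral>z. f z \<partial>\<mu>) - (\<integral>z. f z \<partial>\<nu>)\<bar> \<le> e" if "e > 0" for e
    proof -
      obtain g where g: "real_polynomial_function g"
        and le: "\<And>z. z \<in> sphere 0 1 \<Longrightarrow> \<bar>f z - g z\<bar> < e / 2"
        using Stone_Weierstrass_real_polynomial_function[OF compact_sphere f, of "e / 2"] \<open>e > 0\<close>
        by auto
      have close: "\<bar>(\<integral>z. f z \<partial>L) - (\<integral>z. g z \<partial>L)\<bar> \<le> e / 2" if "circle_prob L" for L
      proof -
        interpret L: circle_prob L by fact
        have gc: "continuous_on (sphere 0 1) g"
          using g by (simp add: continuous_on_polymonial_function real_polynomial_function_eq)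
        have "(\<integral>z. f z \<partial>L) - (\<integral>z. g z \<partial>L) = (\<integral>z. f z - g z \<partial>L)"
          by (simp add: L.integrable_continuous f gc Bochner_Integration.integral_diff)
        also have "norm \<dots> \<le> (\<integral>z. norm (f z - g z) \<partial>L)" by (rule integral_norm_bound)
        also have "\<dots> \<le> (\<integral>z. e / 2 \<partial>L)"
          using le by (intro integral_mono L.integrable_continuous continuous_intros f gc)
            (auto simp: L.space_circle less_imp_le)
        also have "\<dots> = e / 2" by (simp add: L.prob_space)
        finally show ?thesis by simp
      qed
      show ?thesis using close[OF assms(1)] close[OF assms(2)] poly[OF g] by linarith
    qed
    from field_le_epsilon[of "\<bar>(\<integral>z. f z \<partial>\<mu>) - (\<integral>z. f z \<partial>\<nu>)\<bar>" 0] this show ?thesis by simp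
  qed
  have closed: "measure \<mu> (C \<inter> sphere 0 1) = measure \<nu> (C \<inter> sphere 0 1)" if "closed C" for C
  proof (cases "C = {}")
    case False
    \<comment> \<open>Continuous tents that decrease to the indicator of \<open>C\<close>.\<close>
    define h where "h n z = max 0 (1 - real n * infdist z C)" for n and z :: complex
    have h_cont: "continuous_on (sphere 0 1) (h n)" for n
      unfolding h_def by (intro continuous_intros)
    have h_lim: "(\<lambda>n. h n z) \<longlonglongrightarrow> indicator C z" for z
    proof (cases "z \<in> C")
      case True
      then show ?thesis by (simp add: h_def)
    next
      case z: False
      then have pos: "infdist z C > 0"
        using \<open>closed C\<close> False by (metis in_closed_iff_infdist_zero infdist_nonneg less_eq_real_def)
      obtain N where N: "real N * infdist z C > 1"
        using reals_Archimedean3[OF pos] by blast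
      have "h n z = 0" if "n \<ge> N" for n
      proof -
        have "real N * infdist z C \<le> real n * infdist z C"
          using that pos by (intro mult_right_mono) auto
        then show ?thesis using N by (simp add: h_def)
      qed
      then have "(\<lambda>n. h n z) \<longlonglongrightarrow> 0"
        by (intro tendsto_eventually) (auto simp: eventually_sequentially)
      then show ?thesis using z by simp
    qed
    have lim: "(\<lambda>n. \<integral>z. h n z \<partial>L) \<longlonglongrightarrow> measure L (C \<inter> sphere 0 1)" if "circle_prob L" for L
    proof -
      interpret L: circle_prob L by fact
      have C: "C \<inter> sphere 0 1 \<in> sets L"
        using \<open>closed C\<close> by (auto simp: L.sets_circle circle_borel_def sets_restrict_space)
      have "(\<lambda>n. \<integral>z. h n z \<partial>L) \<longlonglongrightarrow> (\<integral>z. indicator (C \<inter> sphere 0 1) z \<partial>L)"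
      proof (rule integral_dominated_convergence[where w = "\<lambda>_. 1"])
        show "AE z in L. (\<lambda>n. h n z) \<longlonglongrightarrow> indicator (C \<inter> sphere 0 1) z"
        proof (rule AE_I2)
          fix z assume "z \<in> space L"
          then have "indicator (C \<inter> sphere 0 1) z = (indicator C z :: real)"
            by (auto simp: L.space_circle indicator_def)
          then show "(\<lambda>n. h n z) \<longlonglongrightarrow> indicator (C \<inter> sphere 0 1) z" using h_lim[of z] by simp
        qed
        show "AE z in L. norm (h n z) \<le> 1" for n
          by (auto simp: h_def infdist_nonneg)
      qed (use C in \<open>auto intro!: L.measurable_continuous h_cont\<close>)
      then show ?thesis using C by simp
    qed
    show ?thesis
      using LIMSEQ_unique[OF lim[OF assms(1)]] lim[OF assms(2)] cont[OF h_cont] by simp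
  qed simp
  \<comment> \<open>Pushing the measures forward to the plane makes the closed sets a generator of the \<open>\<sigma>\<close>-algebra.\<close>
  let ?ext = "\<lambda>L. distr L borel (\<lambda>z::complex. z)"
  have id: "(\<lambda>z. z) \<in> borel_measurable L" if "circle_prob L" for L
  proof -
    interpret L: circle_prob L by fact
    show ?thesis by (intro L.measurable_continuous continuous_intros)
  qed
  have "?ext \<mu> = ?ext \<nu>"
  proof (rule measure_eqI_generator_eq)
    show "Int_stable (Collect closed :: complex set set)"
      by (auto simp: Int_stable_def)
    show "sets (?ext \<mu>) = sigma_sets UNIV (Collect closed)"
      "sets (?ext \<nu>) = sigma_sets UNIV (Collect closed)"
      by (auto simp: borel_eq_closed)
    fix C :: "complex set" assume "C \<in> Collect closed"
    then have "closed C" by simp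
    then have C: "C \<in> sets borel" by simp
    show "emeasure (?ext \<mu>) C = emeasure (?ext \<nu>) C"
      using closed[OF \<open>closed C\<close>]
      by (simp add: emeasure_distr[OF id C] assms(1,2) M.space_circle N.space_circle
          M.emeasure_eq_measure N.emeasure_eq_measure)
  next
    show "range (\<lambda>_::nat. UNIV :: complex set) \<subseteq> Collect closed" by auto
    show "emeasure (?ext \<mu>) UNIV \<noteq> \<infinity>"
      by (simp add: emeasure_distr id assms(1))
  qed auto
  show ?thesis
  proof (rule measure_eqI)
    show "sets \<mu> = sets \<nu>" by (simp add: M.sets_circle N.sets_circle)
    fix A assume A: "A \<in> sets \<mu>"
    then have "A \<subseteq> sphere 0 1" using sets.sets_into_space M.space_circle by blast
    moreover have "A \<in> sets borel"
      using A by (auto simp: M.sets_circle circle_borel_def sets_restrict_space)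
    ultimately show "emeasure \<mu> A = emeasure \<nu> A"
      using arg_cong[OF \<open>?ext \<mu> = ?ext \<nu>\<close>, of "\<lambda>L. emeasure L A"]
      by (simp add: emeasure_distr id assms(1,2) M.space_circle N.space_circle Int_absorb2)
  qed
qed

section \<open>Arc length\<close>

lemma measurable_cis_circle:
  "cis \<in> measurable (uniform_measure lborel {0..<2 * pi}) circle_borel"
proof -
  have "cis \<in> borel_measurable borel"
    by (intro borel_measurable_continuous_onI continuous_intros)
  then have "cis \<in> borel_measurable (uniform_measure lborel {0..<2 * pi})"
    by (simp cong: measurable_cong_sets)
  then show ?thesis
    unfolding circle_borel_def by (rule measurable_restrict_space2[rotated]) auto
qed

lemma circle_prob_arc_length: "circle_prob arc_length_measure"
proof -
  interpret U: prob_space "uniform_measure lborel {0..<2 * pi}"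
    by (rule prob_space_uniform_measure) auto
  have "prob_space arc_length_measure"
    unfolding arc_length_measure_def by (rule U.prob_space_distr[OF measurable_cis_circle])
  then show ?thesis
    by (simp add: circle_prob_def circle_prob_axioms_def arc_length_measure_def)
qed

text \<open>For \<open>k \<noteq> 0\<close> the function \<open>e\<^bsup>ikt\<^esup>\<close> has the \<open>2\<pi>\<close>-periodic primitive \<open>e\<^bsup>ikt\<^esup> / (ik)\<close>.\<close>

lemma arc_length_moment:
  "(\<integral>z. z powi k \<partial>arc_length_measure) = (if k = 0 then 1 else 0)"
proof (cases "k = 0")
  case True
  interpret A: circle_prob arc_length_measure by (rule circle_prob_arc_length)
  show ?thesis using True by (simp add: A.prob_space)
next
  case False
  have cis_k: "(\<lambda>t. cis (of_int k * t)) \<in> borel_measurable borel"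
    by (intro borel_measurable_continuous_onI continuous_intros)
  have "(\<lambda>z::complex. z powi k) \<in> borel_measurable circle_borel"
    unfolding circle_borel_def
    by (intro borel_measurable_continuous_on_restrict continuous_intros) auto
  then have "(\<integral>z. z powi k \<partial>arc_length_measure)
      = (\<integral>t. cis t powi k \<partial>uniform_measure lborel {0..<2 * pi})"
    unfolding arc_length_measure_def by (intro integral_distr measurable_cis_circle)
  also have "\<dots> = (\<integral>t. cis (of_int k * t) \<partial>uniform_measure lborel {0..<2 * pi})"
    by (simp add: cis_power_int)
  also have "uniform_measure lborel {0..<2 * pi}
      = density lborel (\<lambda>t. ennreal (indicator {0..<2 * pi} t / (2 * pi)))"
    unfolding uniform_measure_def
    by (intro density_cong) (auto simp: indicator_def divide_ennreal ennreal_1[symmetric] simp del: ennreal_1)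
  also have "(\<integral>t. cis (of_int k * t) \<partial>\<dots>)
      = (\<integral>t. (indicator {0..<2 * pi} t / (2 * pi)) *\<^sub>R cis (of_int k * t) \<partial>lborel)"
    by (intro integral_density) (use cis_k in auto)
  also have "\<dots> = (\<integral>t. indicator {0..2 * pi} t *\<^sub>R (cis (of_int k * t) / (2 * pi)) \<partial>lborel)"
  proof (rule integral_cong_AE)
    show "AE t in lborel. (indicator {0..<2 * pi} t / (2 * pi)) *\<^sub>R cis (of_int k * t)
        = indicator {0..2 * pi} t *\<^sub>R (cis (of_int k * t) / complex_of_real (2 * pi))"
      using AE_lborel_singleton[of "2 * pi"]
      by eventually_elim (auto simp: indicator_def scaleR_conv_of_real)
  qed (use cis_k in \<open>auto intro!: borel_measurable_scaleR borel_measurable_divide\<close>)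
  also have "\<dots> = cis (of_int k * (2 * pi)) / (\<i> * of_int k * (2 * pi)) - cis (of_int k * 0) / (\<i> * of_int k * (2 * pi))"
  proof (rule integral_FTC_Icc)
    fix t :: real
    have "((\<lambda>w. exp (\<i> * (of_int k * w)) / (\<i> * of_int k * (2 * pi))) has_field_derivative
        exp (\<i> * (of_int k * of_real t)) / complex_of_real (2 * pi)) (at (of_real t))"
      using False by (auto intro!: derivative_eq_intros simp: field_simps)
    from has_vector_derivative_real_field[OF this]
    have "((\<lambda>t. exp (\<i> * (of_int k * of_real t)) / (\<i> * of_int k * (2 * pi))) has_vector_derivative
        exp (\<i> * (of_int k * of_real t)) / complex_of_real (2 * pi)) (at t within {0..2 * pi})" .
    then show "((\<lambda>t. cis (of_int k * t) / (\<i> * of_int k * (2 * pi))) has_vector_derivative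
        cis (of_int k * t) / complex_of_real (2 * pi)) (at t within {0..2 * pi})"
      by (simp add: cis_conv_exp)
  qed (auto intro!: continuous_intros)
  also have "cis (of_int k * (2 * pi)) = 1"
    by (metis Ints_of_int cis_multiple_2pi mult.commute)
  finally show ?thesis using False by simp
qed

section \<open>Gram--Schmidt\<close>

lemma olp_exponent_even [simp]: "olp_exponent (2 * m) = int m"
  by (simp add: olp_exponent_def)

lemma olp_exponent_odd [simp]: "olp_exponent (Suc (2 * m)) = - int (Suc m)"
  by (simp add: olp_exponent_def)

lemma olp_exponent_eq_iff [simp]: "olp_exponent j = olp_exponent k \<longleftrightarrow> j = k"
  by (cases "even j"; cases "even k") (auto elim!: evenE oddE)

lemma olp_exponent_image_even: "olp_exponent ` {..<2 * m} = {- int m..<int m}"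
proof (induction m)
  case (Suc m)
  have "{..<2 * Suc m} = insert (Suc (2 * m)) (insert (2 * m) {..<2 * m})" by auto
  then show ?case using Suc.IH by auto
qed simp

lemma olp_exponent_image_odd: "olp_exponent ` {..<Suc (2 * m)} = {- int m..int m}"
  using olp_exponent_image_even[of m] by (auto simp: lessThan_Suc)

definition olp_residual :: "complex measure \<Rightarrow> nat \<Rightarrow> laurent" where
  "olp_residual \<mu> n = laurent_monom (olp_exponent n) -
     (\<Sum>k<n. laurent_smult (laurent_inner \<mu> (laurent_monom (olp_exponent n)) (olp \<mu> k)) (olp \<mu> k))"

lemma olp_eq:
  "olp \<mu> n = laurent_smult (complex_of_real (1 / laurent_norm \<mu> (olp_residual \<mu> n))) (olp_residual \<mu> n)"
  by (subst olp.simps) (simp add: olp_residual_def Let_def)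

lemma lookup_olp_residual:
  "Poly_Mapping.lookup (olp_residual \<mu> n) l = (if l = olp_exponent n then 1 else 0) -
     (\<Sum>k<n. laurent_inner \<mu> (laurent_monom (olp_exponent n)) (olp \<mu> k)
        * Poly_Mapping.lookup (olp \<mu> k) l)"
  by (simp add: olp_residual_def lookup_minus lookup_sum lookup_laurent_monom)

lemma keys_olp: "Poly_Mapping.keys (olp \<mu> n) \<subseteq> olp_exponent ` {..n}"
proof (induction n rule: less_induct)
  case (less n)
  show ?case
  proof
    fix l assume "l \<in> Poly_Mapping.keys (olp \<mu> n)"
    then have "Poly_Mapping.lookup (olp_residual \<mu> n) l \<noteq> 0"
      by (subst (asm) olp_eq) (auto simp: in_keys_iff)
    then have "l = olp_exponent n \<or> (\<exists>k<n. Poly_Mapping.lookup (olp \<mu> k) l \<noteq> 0)"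
      unfolding lookup_olp_residual by (auto split: if_splits intro: sum.neutral)
    then show "l \<in> olp_exponent ` {..n}"
    proof
      assume "\<exists>k<n. Poly_Mapping.lookup (olp \<mu> k) l \<noteq> 0"
      then obtain k where "k < n" "l \<in> Poly_Mapping.keys (olp \<mu> k)"
        by (auto simp: in_keys_iff)
      then have "l \<in> olp_exponent ` {..k}" using less by blast
      then show ?thesis using \<open>k < n\<close> by auto
    qed auto
  qed
qed

text \<open>The earlier orthonormal functions do not involve the new exponent, so nothing cancels the new
  monomial. In particular the residual is never zero.\<close>

lemma lookup_olp_residual_leading:
  "Poly_Mapping.lookup (olp_residual \<mu> n) (olp_exponent n) = 1"
proof -
  have "Poly_Mapping.lookup (olp \<mu> k) (olp_exponent n) = 0" if "k < n" for k
  proof -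
    have "olp_exponent n \<notin> olp_exponent ` {..k}" using that by auto
    then show ?thesis using keys_olp[of \<mu> k] by (auto simp: in_keys_iff)
  qed
  then show ?thesis by (simp add: lookup_olp_residual)
qed

locale circle_prob_infinite = circle_prob +
  assumes infinite_support: "infinite (measure_support \<mu>)"
begin

lemma olp_residual_norm_pos: "laurent_norm \<mu> (olp_residual \<mu> n) > 0"
proof (rule laurent_norm_pos[OF infinite_support])
  show "olp_residual \<mu> n \<noteq> 0"
    using lookup_olp_residual_leading[of \<mu> n] by auto
qed

lemma lookup_olp_leading: "Poly_Mapping.lookup (olp \<mu> n) (olp_exponent n) \<noteq> 0"
  using olp_residual_norm_pos[of n] by (subst olp_eq) (simp add: lookup_olp_residual_leading)

lemma olp_residual_eq: "olp_residual \<mu> n = laurent_smult (of_real (laurent_norm \<mu> (olp_residual \<mu> n))) (olp \<mu> n)"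
  using olp_residual_norm_pos[of n]
  by (subst olp_eq) (auto intro!: poly_mapping_eqI)

lemma olp_norm: "laurent_inner \<mu> (olp \<mu> n) (olp \<mu> n) = 1"
proof -
  let ?y = "olp_residual \<mu> n" and ?N = "complex_of_real (laurent_norm \<mu> (olp_residual \<mu> n))"
  have "?N \<noteq> 0" using olp_residual_norm_pos[of n] by simp
  have y: "laurent_inner \<mu> ?y q = ?N * laurent_inner \<mu> (olp \<mu> n) q" for q
    by (subst olp_residual_eq) (rule laurent_inner_smult_left)
  have "?N\<^sup>2 = ?N * laurent_inner \<mu> (olp \<mu> n) ?y"
    unfolding laurent_norm_square by (rule y)
  also have "\<dots> = ?N * cnj (?N * laurent_inner \<mu> (olp \<mu> n) (olp \<mu> n))"
    by (simp only: laurent_inner_cnj[of "olp \<mu> n" ?y] y)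
  also have "\<dots> = ?N\<^sup>2 * cnj (laurent_inner \<mu> (olp \<mu> n) (olp \<mu> n))"
    by (simp add: power2_eq_square)
  finally show ?thesis using \<open>?N \<noteq> 0\<close> by (simp add: complex_eq_iff)
qed

lemma olp_orthogonal:
  assumes "k < n"
  shows "laurent_inner \<mu> (olp \<mu> n) (olp \<mu> k) = 0"
  using assms
proof (induction n arbitrary: k rule: less_induct)
  case (less n)
  have orth: "laurent_inner \<mu> (olp \<mu> i) (olp \<mu> k) = (if i = k then 1 else 0)" if "i < n" for i
  proof (cases i k rule: linorder_cases)
    case less1: less
    then have "laurent_inner \<mu> (olp \<mu> k) (olp \<mu> i) = 0" using less.IH less.prems by blast
    then show ?thesis using less1 laurent_inner_cnj[of "olp \<mu> i" "olp \<mu> k"] by simp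
  qed (use less.IH that olp_norm in auto)
  have "laurent_inner \<mu> (olp_residual \<mu> n) (olp \<mu> k) = 0"
    using less.prems
    by (simp add: olp_residual_def laurent_inner_diff_left laurent_inner_sum_left
        laurent_inner_smult_left orth if_distrib cong: if_cong)
  then show ?case by (subst olp_eq) (simp add: laurent_inner_smult_left)
qed

lemma olp_orthogonal_monom:
  assumes "k < n"
  shows "laurent_inner \<mu> (laurent_monom (olp_exponent k)) (olp \<mu> n) = 0"
proof -
  have o: "laurent_inner \<mu> (olp \<mu> i) (olp \<mu> n) = 0" if "i \<le> k" for i
    using olp_orthogonal[of i n] that assms laurent_inner_cnj[of "olp \<mu> i" "olp \<mu> n"] by simp
  have "laurent_inner \<mu> (olp_residual \<mu> k) (olp \<mu> n) = 0"
    by (subst olp_residual_eq, subst laurent_inner_smult_left) (simp add: o)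
  then show ?thesis
    by (simp add: olp_residual_def laurent_inner_diff_left laurent_inner_sum_left
        laurent_inner_smult_left o)
qed

text \<open>If Gram--Schmidt returns a multiple of the new monomial, this monomial is already orthogonal to
  all earlier ones, and an inner product of monomials is a moment.\<close>

lemma moment_zero_of_olp_monom:
  assumes "Poly_Mapping.keys (olp \<mu> n) \<subseteq> {olp_exponent n}"
    and "l \<in> olp_exponent ` {..<n}"
  shows "(\<integral>z. z powi (olp_exponent n - l) \<partial>\<mu>) = 0"
proof -
  obtain k where "k < n" and l: "l = olp_exponent k" using assms(2) by auto
  let ?c = "Poly_Mapping.lookup (olp \<mu> n) (olp_exponent n)"
  have "olp \<mu> n = laurent_smult ?c (laurent_monom (olp_exponent n))"
    using assms(1) by (intro poly_mapping_eqI) (auto simp: lookup_laurent_monom in_keys_iff)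
  then have "laurent_inner \<mu> (olp \<mu> n) (laurent_monom (olp_exponent k)) =
      ?c * laurent_inner \<mu> (laurent_monom (olp_exponent n)) (laurent_monom (olp_exponent k))"
    by (metis laurent_inner_smult_left)
  moreover have "laurent_inner \<mu> (olp \<mu> n) (laurent_monom (olp_exponent k)) = 0"
    using olp_orthogonal_monom[OF \<open>k < n\<close>]
      laurent_inner_cnj[of "olp \<mu> n" "laurent_monom (olp_exponent k)"] by simp
  ultimately show ?thesis using lookup_olp_leading[of n] by (simp add: l laurent_inner_monom)
qed

end

section \<open>Eigenoperators are diagonal\<close>

lemma poly_eq_0_of_cofinite_roots:
  fixes P :: "complex poly"
  assumes "s \<noteq> 0" and "\<And>m. m > N \<Longrightarrow> poly P (of_int (s * int m)) = 0"
  shows "P = 0"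
proof (rule ccontr)
  assume "P \<noteq> 0"
  then have "finite {z. poly P z = 0}" by (rule poly_roots_finite)
  moreover have "(\<lambda>m. of_int (s * int m)) ` {N<..} \<subseteq> {z. poly P z = 0}"
    using assms(2) by auto
  ultimately have "finite ((\<lambda>m. of_int (s * int m) :: complex) ` {N<..})"
    using finite_subset by blast
  then show False
    using assms(1) by (subst (asm) finite_image_iff) (auto simp: inj_on_def infinite_Ioi)
qed

text \<open>Take for \<open>b\<close> the maximum of \<open>|P|\<close> on \<open>[-N, N]\<close> and for \<open>m\<close> the first radius at which \<open>b\<close> is
  exceeded. It exists because a nonconstant polynomial tends to infinity. The two signs have to be
  treated together: \<open>|P|\<close> may take equal values at \<open>m\<close> and \<open>-m\<close>.\<close>

lemma record_radius:
  fixes P :: "complex poly"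
  assumes "degree P > 0"
  obtains m b where "m > N"
    and "norm (poly P (of_int (int m))) > b \<or> norm (poly P (of_int (- int m))) > b"
    and "\<And>k. \<bar>k\<bar> < int m \<Longrightarrow> norm (poly P (of_int k)) \<le> b"
proof -
  let ?v = "\<lambda>k::int. norm (poly P (of_int k))"
  define b where "b = Max (?v ` {- int N..int N})"
  have b: "?v k \<le> b" if "\<bar>k\<bar> \<le> int N" for k
    unfolding b_def using that by (intro Max_ge imageI finite_imageI) auto
  define R where "R m \<longleftrightarrow> ?v (int m) > b \<or> ?v (- int m) > b" for m
  obtain a p where P: "P = pCons a p" by (cases P)
  then have "p \<noteq> 0" using assms by auto
  then obtain r where r: "\<And>z. r \<le> norm z \<Longrightarrow> b + 1 \<le> norm (poly P z)"
    using poly_infinity[of p "b + 1" a] P by blast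
  obtain M :: nat where "r \<le> M" using real_arch_simple by blast
  then have "R M" using r[of "of_nat M"] by (simp add: R_def)
  define m where "m = (LEAST m. R m)"
  have "R m" unfolding m_def by (rule LeastI) fact
  moreover have "\<not> m \<le> N" using \<open>R m\<close> b[of "int m"] b[of "- int m"] by (auto simp: R_def)
  moreover have "?v k \<le> b" if "\<bar>k\<bar> < int m" for k
  proof -
    have "nat \<bar>k\<bar> < m" using that by linarith
    then have "\<not> R (nat \<bar>k\<bar>)" unfolding m_def by (rule not_less_Least)
    then show ?thesis by (cases "k \<ge> 0") (auto simp: R_def)
  qed
  ultimately show thesis using that[of m b] by (auto simp: R_def)
qed

context circle_prob_infinite
begin

text \<open>At an extremal shift \<open>i\<close> only the newest monomial of \<open>x\<^sub>n\<close> is moved to the exponent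
  \<open>e\<^sub>n + i\<close>, where \<open>e\<^sub>n\<close> is the exponent of that monomial. This position is outside the exponents
  of \<open>x\<^sub>n\<close>, so the eigenvalue equation forces \<open>P\<^sub>i(e\<^sub>n) = 0\<close>. Even \<open>n\<close> treat the largest shift,
  odd \<open>n\<close> the smallest one.\<close>

lemma eigen_shift_symbol_zero:
  assumes D: "\<And>p. D p = (\<Sum>i\<le>r. a i * (laurent_deriv ^^ i) p)"
    and eig: "\<And>n. n > N \<Longrightarrow> \<exists>c. D (olp \<mu> n) = laurent_smult c (olp \<mu> n)"
    and "j \<noteq> 0"
  shows "shift_symbol r a j = 0"
proof -
  let ?P = "shift_symbol r a"
  let ?J = "{j. ?P j \<noteq> 0}"
  let ?x = "olp \<mu>"
  have fin: "finite ?J" by (rule finite_shift_symbol_nonzero)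
  have shift: "poly (?P i) (of_int (olp_exponent n)) = 0"
    if "n > N" and out: "olp_exponent n + i \<notin> olp_exponent ` {..n}"
      and ext: "\<And>l. l \<in> olp_exponent ` {..<n} \<Longrightarrow> ?P (olp_exponent n + i - l) = 0" for n i
  proof -
    let ?e = "olp_exponent n"
    obtain c where c: "D (?x n) = laurent_smult c (?x n)" using eig[OF \<open>n > N\<close>] by blast
    have "Poly_Mapping.lookup (?x n) (?e + i) = 0"
      using keys_olp[of \<mu> n] out by (auto simp: in_keys_iff)
    then have "0 = Poly_Mapping.lookup (D (?x n)) (?e + i)" by (simp add: c)
    also have "\<dots> = (\<Sum>k\<in>Poly_Mapping.keys (?x n).
        poly (?P (?e + i - k)) (of_int k) * Poly_Mapping.lookup (?x n) k)"
      by (rule lookup_diff_operator) (rule D)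
    also have "\<dots> = (\<Sum>k\<in>Poly_Mapping.keys (?x n).
        if k = ?e then poly (?P i) (of_int ?e) * Poly_Mapping.lookup (?x n) ?e else 0)"
    proof (rule sum.cong[OF refl])
      fix k assume "k \<in> Poly_Mapping.keys (?x n)"
      then have "k \<in> olp_exponent ` {..n}" using keys_olp by blast
      then have "k = ?e \<or> k \<in> olp_exponent ` {..<n}" by (auto simp: le_less)
      then show "poly (?P (?e + i - k)) (of_int k) * Poly_Mapping.lookup (?x n) k =
          (if k = ?e then poly (?P i) (of_int ?e) * Poly_Mapping.lookup (?x n) ?e else 0)"
        using ext by auto
    qed
    also have "\<dots> = poly (?P i) (of_int ?e) * Poly_Mapping.lookup (?x n) ?e"
      using lookup_olp_leading[of n] by (simp add: in_keys_iff)
    finally show ?thesis using lookup_olp_leading[of n] by simp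
  qed
  have "j' \<le> 0" if "?P j' \<noteq> 0" for j'
  proof (rule ccontr)
    assume "\<not> j' \<le> 0"
    define J where "J = Max ?J"
    have J: "J > 0" "?P J \<noteq> 0" "\<And>i. i > J \<Longrightarrow> ?P i = 0"
      using Max_in[OF fin] Max_ge[OF fin] that \<open>\<not> j' \<le> 0\<close> by (fastforce simp: J_def)+
    have "poly (?P J) (of_int (1 * int m)) = 0" if "m > N" for m
      using shift[of "2 * m" J] that J
      by (simp add: olp_exponent_image_even olp_exponent_image_odd flip: lessThan_Suc_atMost)
    then have "?P J = 0" by (intro poly_eq_0_of_cofinite_roots[of 1 N]) simp_all
    with J show False by simp
  qed
  moreover have "j' \<ge> 0" if "?P j' \<noteq> 0" for j'
  proof (rule ccontr)
    assume "\<not> j' \<ge> 0"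
    define J where "J = Min ?J"
    have J: "J < 0" "?P J \<noteq> 0" "\<And>i. i < J \<Longrightarrow> ?P i = 0"
      using Min_in[OF fin] Min_le[OF fin] that \<open>\<not> j' \<ge> 0\<close> by (fastforce simp: J_def)+
    have "poly (?P J) (of_int (- 1 * int m)) = 0" if "m > N" for m
    proof -
      obtain m' where m': "m = Suc m'" using \<open>m > N\<close> by (cases m) auto
      let ?n = "Suc (2 * m')"
      have upto: "{..?n} = {..<2 * m}" and e: "olp_exponent ?n = - int m"
        using m' by auto
      have "olp_exponent ?n + J \<notin> olp_exponent ` {..?n}"
        unfolding upto e olp_exponent_image_even using J by simp
      moreover have "?P (olp_exponent ?n + J - l) = 0" if "l \<in> olp_exponent ` {..<?n}" for l
        using that J unfolding e olp_exponent_image_odd by (simp add: m')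
      ultimately show ?thesis
        using shift[of ?n J] \<open>m > N\<close> m' by (simp add: e)
    qed
    then have "?P J = 0" by (intro poly_eq_0_of_cofinite_roots[of "-1" N]) simp_all
    with J show False by simp
  qed
  ultimately show ?thesis using \<open>j \<noteq> 0\<close> by fastforce
qed

section \<open>Vanishing moments\<close>

text \<open>A diagonal operator \<open>P(\<theta>)\<close> has \<open>x\<^sub>n\<close> as an eigenfunction only if \<open>P\<close> is constant on the
  exponents of \<open>x\<^sub>n\<close>. At a record radius \<open>m\<close> of \<open>|P|\<close> this leaves a single exponent
  in \<open>x\<^sub>2\<^sub>m\<^sub>-\<^sub>1\<close> or in \<open>x\<^sub>2\<^sub>m\<close>, so the moments of absolute exponent below \<open>m\<close> vanish.\<close>

lemma eigenoperator_imp_moments_zero: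
  assumes "r \<ge> 1" "is_diff_operator r D"
    and fin: "finite {n. \<not> (\<exists>c. D (olp \<mu> n) = laurent_smult c (olp \<mu> n))}"
    and "j \<noteq> 0"
  shows "(\<integral>z. z powi j \<partial>\<mu>) = 0"
proof -
  obtain a where ar: "a r \<noteq> 0" and D: "\<And>p. D p = (\<Sum>i\<le>r. a i * (laurent_deriv ^^ i) p)"
    using assms(2) unfolding is_diff_operator_def by blast
  obtain N where "\<And>n. \<not> (\<exists>c. D (olp \<mu> n) = laurent_smult c (olp \<mu> n)) \<Longrightarrow> n \<le> N"
    using fin unfolding finite_nat_set_iff_bounded_le by blast
  then have eig: "\<exists>c. D (olp \<mu> n) = laurent_smult c (olp \<mu> n)" if "n > N" for n
    using that not_less by blast
  define P where "P = shift_symbol r a 0"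
  have zero: "shift_symbol r a j = 0" if "j \<noteq> 0" for j
    using eigen_shift_symbol_zero[of D a r N j] D eig that by blast
  obtain l where "Poly_Mapping.lookup (a r) l \<noteq> 0"
    using ar by (metis lookup_zero poly_mapping_eqI)
  then have "coeff (shift_symbol r a (l - int r)) r \<noteq> 0"
    by (simp add: coeff_shift_symbol)
  moreover from this have "shift_symbol r a (l - int r) \<noteq> 0" by auto
  then have "l - int r = 0" using zero by blast
  ultimately have "degree P > 0"
    using \<open>r \<ge> 1\<close> le_degree[of P r] by (simp add: P_def)
  have lookup_D: "Poly_Mapping.lookup (D p) l = poly P (of_int l) * Poly_Mapping.lookup p l" for p l
  proof -
    have "Poly_Mapping.lookup (D p) l = (\<Sum>k\<in>Poly_Mapping.keys p.
        poly (shift_symbol r a (l - k)) (of_int k) * Poly_Mapping.lookup p k)"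
      by (rule lookup_diff_operator) (rule D)
    also have "\<dots> = (\<Sum>k\<in>Poly_Mapping.keys p.
        if k = l then poly P (of_int l) * Poly_Mapping.lookup p l else 0)"
      by (rule sum.cong) (auto simp: P_def zero)
    also have "\<dots> = poly P (of_int l) * Poly_Mapping.lookup p l"
      by (auto simp: in_keys_iff)
    finally show ?thesis .
  qed
  have keys: "poly P (of_int l) = poly P (of_int (olp_exponent n))"
    if "n > N" "l \<in> Poly_Mapping.keys (olp \<mu> n)" for n l
  proof -
    obtain c where c: "D (olp \<mu> n) = laurent_smult c (olp \<mu> n)" using eig[OF \<open>n > N\<close>] by blast
    have "poly P (of_int l) = c" if "Poly_Mapping.lookup (olp \<mu> n) l \<noteq> 0" for l
      using lookup_D[of "olp \<mu> n" l] that by (simp add: c)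
    then show ?thesis using that(2) lookup_olp_leading by (metis in_keys_iff)
  qed
  \<comment> \<open>The radius exceeds \<open>N\<close> to reach eigenfunctions, and \<open>|j|\<close> so that the monomials at distance
    \<open>|j|\<close> from the extremal one come earlier in the order.\<close>
  obtain m b where m: "m > N + nat \<bar>j\<bar>"
    and big: "norm (poly P (of_int (int m))) > b \<or> norm (poly P (of_int (- int m))) > b"
    and small: "\<And>k. \<bar>k\<bar> < int m \<Longrightarrow> norm (poly P (of_int k)) \<le> b"
    using record_radius[OF \<open>degree P > 0\<close>] by blast
  have "(\<integral>z. z powi \<bar>j\<bar> \<partial>\<mu>) = 0 \<or> (\<integral>z. z powi (- \<bar>j\<bar>) \<partial>\<mu>) = 0"
  proof (cases "norm (poly P (of_int (- int m))) > b")
    case True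
    obtain m' where m': "m = Suc m'" using m by (cases m) auto
    let ?n = "Suc (2 * m')"
    have "{..?n} = {..<2 * m}" by (auto simp: m')
    have "?n > N" using m m' by simp
    have "Poly_Mapping.keys (olp \<mu> ?n) \<subseteq> {olp_exponent ?n}"
    proof
      fix l assume l: "l \<in> Poly_Mapping.keys (olp \<mu> ?n)"
      then have "norm (poly P (of_int l)) > b"
        using keys[OF \<open>?n > N\<close> l] True by (simp add: m')
      then have "\<not> \<bar>l\<bar> < int m" using small[of l] by linarith
      moreover have "l \<in> {- int m..<int m}"
        using l keys_olp[of \<mu> ?n] olp_exponent_image_even[of m] \<open>{..?n} = {..<2 * m}\<close> by auto
      ultimately show "l \<in> {olp_exponent ?n}" by (auto simp: m')
    qed
    moreover have "- int m + \<bar>j\<bar> \<in> olp_exponent ` {..<?n}"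
      using m \<open>j \<noteq> 0\<close> unfolding olp_exponent_image_odd by (auto simp: m')
    ultimately have "(\<integral>z. z powi (olp_exponent ?n - (- int m + \<bar>j\<bar>)) \<partial>\<mu>) = 0"
      by (rule moment_zero_of_olp_monom)
    moreover have "olp_exponent ?n - (- int m + \<bar>j\<bar>) = - \<bar>j\<bar>" by (simp add: m')
    ultimately show ?thesis by (simp only: simp_thms)
  next
    case False
    then have True: "norm (poly P (of_int (int m))) > b" using big by blast
    let ?n = "2 * m"
    have "?n > N" using m by simp
    have "Poly_Mapping.keys (olp \<mu> ?n) \<subseteq> {olp_exponent ?n}"
    proof
      fix l assume l: "l \<in> Poly_Mapping.keys (olp \<mu> ?n)"
      then have P: "norm (poly P (of_int l)) > b"
        using keys[OF \<open>?n > N\<close> l] True by simp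
      then have "\<not> \<bar>l\<bar> < int m" using small[of l] by linarith
      moreover have "l \<noteq> - int m" using P False by auto
      moreover have "l \<in> {- int m..int m}"
        using l keys_olp[of \<mu> ?n] olp_exponent_image_odd[of m] by (auto simp: lessThan_Suc_atMost)
      ultimately show "l \<in> {olp_exponent ?n}" by auto
    qed
    moreover have "int m - \<bar>j\<bar> \<in> olp_exponent ` {..<?n}"
      using m \<open>j \<noteq> 0\<close> unfolding olp_exponent_image_even by auto
    ultimately have "(\<integral>z. z powi (olp_exponent ?n - (int m - \<bar>j\<bar>)) \<partial>\<mu>) = 0"
      by (rule moment_zero_of_olp_monom)
    moreover have "olp_exponent ?n - (int m - \<bar>j\<bar>) = \<bar>j\<bar>" by simp
    ultimately show ?thesis by (simp only: simp_thms)
  qed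
  moreover have "(\<integral>z. z powi (- k) \<partial>\<mu>) = cnj (\<integral>z. z powi k \<partial>\<mu>)" for k
    using laurent_inner_cnj[of "laurent_monom 0" "laurent_monom k"]
    by (simp add: laurent_inner_monom)
  ultimately have "(\<integral>z. z powi \<bar>j\<bar> \<partial>\<mu>) = 0 \<and> (\<integral>z. z powi (- \<bar>j\<bar>) \<partial>\<mu>) = 0"
    by (metis complex_cnj_zero_iff)
  then show ?thesis by (cases "j \<ge> 0") auto
qed

end

section \<open>Orthonormal functions of arc length\<close>

lemma olp_arc_length: "olp arc_length_measure n = laurent_monom (olp_exponent n)"
proof (induction n rule: less_induct)
  case (less n)
  interpret A: circle_prob arc_length_measure by (rule circle_prob_arc_length)
  have inner: "laurent_inner arc_length_measure (laurent_monom j) (laurent_monom k)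
      = (if j = k then 1 else 0)" for j k
    by (simp add: A.laurent_inner_monom arc_length_moment)
  have "olp_residual arc_length_measure n = laurent_monom (olp_exponent n)"
    using less by (auto simp: olp_residual_def inner laurent_smult_def)
  moreover have "laurent_norm arc_length_measure (laurent_monom (olp_exponent n)) = 1"
    by (simp add: laurent_norm_def inner)
  ultimately show ?case by (subst olp_eq) (simp add: laurent_smult_def)
qed

text \<open>The factor \<open>z\<close> undoes the shift of the exponent by \<open>d/dz\<close>, so \<open>\<theta> = z d/dz\<close> is diagonal in the
  monomials.\<close>

lemma euler_operator:
  "is_diff_operator 1 (\<lambda>p. laurent_monom 1 * laurent_deriv p)"
proof -
  have "laurent_monom 1 \<noteq> 0"
    by (metis lookup_laurent_monom lookup_zero zero_neq_one)
  then show ?thesis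
    unfolding is_diff_operator_def
    by (intro exI[of _ "\<lambda>i. if i = 1 then laurent_monom 1 else 0"]) simp
qed

lemma euler_operator_monom:
  "laurent_monom 1 * laurent_deriv (laurent_monom k) = laurent_smult (of_int k) (laurent_monom k)"
  by (simp add: laurent_deriv_def laurent_monom_def laurent_smult_def mult_single del: single_of_int)

theorem corollary6p6:
  fixes \<mu> :: "complex measure"
  assumes "prob_space \<mu>"
    and "sets \<mu> = sets circle_borel"
    and "infinite (measure_support \<mu>)"
  shows "(\<exists>r D. r \<ge> 1 \<and> is_diff_operator r D \<and>
            finite {n. \<not> (\<exists>c::complex. D (olp \<mu> n) = laurent_smult c (olp \<mu> n))})
         \<longleftrightarrow> \<mu> = arc_length_measure"
proof
  interpret prob_space \<mu> by fact
  interpret circle_prob_infinite \<mu> by unfold_locales fact+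
  assume "\<exists>r D. r \<ge> 1 \<and> is_diff_operator r D \<and>
            finite {n. \<not> (\<exists>c::complex. D (olp \<mu> n) = laurent_smult c (olp \<mu> n))}"
  then have zero: "(\<integral>z. z powi j \<partial>\<mu>) = 0" if "j \<noteq> 0" for j
    using eigenoperator_imp_moments_zero that by blast
  show "\<mu> = arc_length_measure"
  proof (rule circle_prob_eqI[OF _ circle_prob_arc_length])
    show "circle_prob \<mu>" by unfold_locales
    show "(\<integral>z. z powi k \<partial>\<mu>) = (\<integral>z. z powi k \<partial>arc_length_measure)" for k
      unfolding arc_length_moment by (simp add: zero prob_space)
  qed
next
  have ex_eigen: "\<exists>c. laurent_smult (of_int k) (laurent_monom k) = laurent_smult c (laurent_monom k)" for k
    by blast
  assume "\<mu> = arc_length_measure"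
  then show "\<exists>r D. r \<ge> 1 \<and> is_diff_operator r D \<and>
            finite {n. \<not> (\<exists>c::complex. D (olp \<mu> n) = laurent_smult c (olp \<mu> n))}"
    by (intro exI[of _ 1] exI[of _ "\<lambda>p. laurent_monom 1 * laurent_deriv p"])
       (use euler_operator in \<open>simp add: olp_arc_length euler_operator_monom ex_eigen\<close>)
qed

end
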